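(* Let $(X,T)$ be a cascade. If $(X,T)$ has a weakly mixing enveloping semigroup, i.e. the system $(E(X),T_* )$ is weakly mixing, then $(X,T)$ is weakly rigid.
   Context: A cascade $(X,T)$ is a homeomorphism $T$ of a compact Hausdorff space $X$ (not necessarily metrizable). Its enveloping semigroup $E(X)=E(X,T)$ is the closure of $\{T^i : i \in \mathbb{Z}\}$ in $X^X$ (product topology), regarded as a cascade under the homeomorphism $T_* : p \mapsto T\circ p$. A cascade $(Y,S)$ is transitive if for all nonempty open $U,V\subset Y$ there is $i\in\mathbb{Z}$ with $U\cap S^{-i}(V)\neq\emptyset$. It is weakly mixing if $(Y\times Y,S\times S)$ is transitive. For a cascade $(Y,S)$ and $y\in Y$, $\omega(y)$ and $\alpha(y)$ denote the sets of limit (cluster) points of the bi-infinite sequence $(S^i y)_{i\in\mathbb{Z}}$ as $i\to+\infty$ and $i\to-\infty$ respectively, i.e. $\omega(y)=\bigcap_{N\ge 1}\overline{\{S^i y: i\ge N\}}$ and $\alpha(y)=\bigcap_{N\ge1}\overline{\{S^{i}y: i\le -N\}}$. A point $y$ is recurrent if $y\in\alpha(y)\cup\omega(y)$. The cascade $(X,T)$ is weakly rigid if the identity map $\mathrm{Id}_X$ is a recurrent point of $(E(X),T_* )$. *)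

theory Defs
  imports "HOL-Analysis.Analysis"
begin

definition cascade :: "'a topology \<Rightarrow> ('a \<Rightarrow> 'a) \<Rightarrow> bool" where
  "cascade X T \<longleftrightarrow> compact_space X \<and> Hausdorff_space X \<and> homeomorphic_map X X T"

text \<open>The iterate \<open>T\<^sup>i\<close> for an integer \<open>i\<close>. The inverse of \<open>T\<close> is taken relative to the
  carrier \<open>A\<close>, so that \<open>T\<close> need only be a bijection of \<open>A\<close> onto itself; the value at
  points outside \<open>A\<close> is irrelevant.\<close>

definition int_iterate :: "'a set \<Rightarrow> ('a \<Rightarrow> 'a) \<Rightarrow> int \<Rightarrow> 'a \<Rightarrow> 'a" where
  "int_iterate A T i = (if 0 \<le> i then T ^^ nat i else inv_into A T ^^ nat (- i))"

definition transitive_cascade :: "'a topology \<Rightarrow> ('a \<Rightarrow> 'a) \<Rightarrow> bool" where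
  "transitive_cascade Y S \<longleftrightarrow>
     (\<forall>U V. openin Y U \<and> U \<noteq> {} \<and> openin Y V \<and> V \<noteq> {} \<longrightarrow>
        (\<exists>i. U \<inter> int_iterate (topspace Y) S i -` V \<noteq> {}))"

definition weakly_mixing :: "'a topology \<Rightarrow> ('a \<Rightarrow> 'a) \<Rightarrow> bool" where
  "weakly_mixing Y S \<longleftrightarrow> transitive_cascade (prod_topology Y Y) (map_prod S S)"

definition omega_limit :: "'a topology \<Rightarrow> ('a \<Rightarrow> 'a) \<Rightarrow> 'a \<Rightarrow> 'a set" where
  "omega_limit Y S y =
     (\<Inter>N\<in>{1..}. Y closure_of {int_iterate (topspace Y) S i y | i. i \<ge> N})"

definition alpha_limit :: "'a topology \<Rightarrow> ('a \<Rightarrow> 'a) \<Rightarrow> 'a \<Rightarrow> 'a set" where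
  "alpha_limit Y S y =
     (\<Inter>N\<in>{1..}. Y closure_of {int_iterate (topspace Y) S i y | i. i \<le> - N})"

definition recurrent_point :: "'a topology \<Rightarrow> ('a \<Rightarrow> 'a) \<Rightarrow> 'a \<Rightarrow> bool" where
  "recurrent_point Y S y \<longleftrightarrow> y \<in> alpha_limit Y S y \<union> omega_limit Y S y"

text \<open>Self-maps of \<open>topspace X\<close> are represented by extensional functions, i.e. as
  points of the product of copies of \<open>X\<close> indexed by \<open>topspace X\<close>.\<close>

definition enveloping_semigroup :: "'a topology \<Rightarrow> ('a \<Rightarrow> 'a) \<Rightarrow> ('a \<Rightarrow> 'a) topology" where
  "enveloping_semigroup X T =
     (let P = product_topology (\<lambda>_. X) (topspace X)
      in subtopology P
           (P closure_of (range (\<lambda>i. restrict (int_iterate (topspace X) T i) (topspace X)))))"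

definition enveloping_map :: "'a topology \<Rightarrow> ('a \<Rightarrow> 'a) \<Rightarrow> ('a \<Rightarrow> 'a) \<Rightarrow> ('a \<Rightarrow> 'a)" where
  "enveloping_map X T p = compose (topspace X) T p"

definition weakly_rigid :: "'a topology \<Rightarrow> ('a \<Rightarrow> 'a) \<Rightarrow> bool" where
  "weakly_rigid X T \<longleftrightarrow>
     recurrent_point (enveloping_semigroup X T) (enveloping_map X T) (restrict id (topspace X))"

end

theory Submission
  imports Defs
begin

text \<open>
  The identity has a dense orbit in the enveloping semigroup, so the claim is an instance of a
  general fact: in a weakly mixing \<open>T\<^sub>1\<close> system \<open>(Y, S)\<close>, every point \<open>y\<close> with
  dense orbit is recurrent (\<open>dense_orbit_recurrent_of_weakly_mixing\<close>).

  For if \<open>y\<close> is not recurrent, then some neighbourhood of \<open>y\<close> contains \<open>S\<^sup>i y\<close> for only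
  finitely many \<open>i\<close>; by density of the orbit that neighbourhood lies inside a finite set, so
  \<open>y\<close> is an isolated point. Now \<open>{(y, y)}\<close> and \<open>{y} \<times> (Y - {y})\<close> are both open, and no
  iterate of \<open>S \<times> S\<close> can move the first into the second, since it moves \<open>(y, y)\<close> along the
  diagonal. Weak mixing therefore forces \<open>Y = {y}\<close>, and then \<open>y\<close> is a fixed point, hence
  recurrent after all.
\<close>

text \<open>Backward iterates are built from \<open>inv_into\<close>, that is, from a choice of preimage. On a
  bi-infinite orbit a preimage is already known to exist, so injectivity of \<open>S\<close> alone pins the
  choice down. Applied to \<open>S\<close> and to \<open>S \<times> S\<close>, this shows that \<open>S \<times> S\<close> keeps the diagonal
  orbit on the diagonal in both time directions.\<close>

lemma int_iterate_bi_infinite_orbit: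
  fixes z :: "int \<Rightarrow> 'a"
  assumes inj: "inj_on S A"
    and zA: "\<And>i. z i \<in> A"
    and step: "\<And>i. S (z i) = z (i + 1)"
  shows "int_iterate A S i (z 0) = z i"
proof -
  have forward: "(S ^^ n) (z 0) = z (int n)" for n
    by (induction n) (auto simp: step add.commute)
  have previous: "inv_into A S (z j) = z (j - 1)" for j
    using inv_into_f_f[OF inj zA, of "j - 1"] step[of "j - 1"] by simp
  have backward: "(inv_into A S ^^ n) (z 0) = z (- int n)" for n
    by (induction n) (auto simp: previous intro!: arg_cong[of _ _ z])
  show ?thesis
    by (auto simp: int_iterate_def forward backward)
qed

text \<open>Both tails of the orbit stay away from \<open>z 0\<close>, and the closure of the whole orbit is the
  union of the closures of the two tails and the finite middle segment. Removing the two closed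
  tails and the rest of the middle segment from \<open>Y\<close> thus leaves an open set with the single
  point \<open>z 0\<close>. The middle segment may be empty or may meet the tails, so periodic orbits need
  no separate treatment.\<close>

lemma isolated_of_nonrecurrent_dense_orbit:
  fixes z :: "int \<Rightarrow> 'a"
  assumes t1: "t1_space Y"
    and inj: "inj_on S (topspace Y)"
    and zY: "\<And>i. z i \<in> topspace Y"
    and step: "\<And>i. S (z i) = z (i + 1)"
    and dense: "Y closure_of (range z) = topspace Y"
    and nonrec: "\<not> recurrent_point Y S (z 0)"
  shows "openin Y {z 0}"
proof -
  have orbit: "int_iterate (topspace Y) S i (z 0) = z i" for i
    using inj zY step by (rule int_iterate_bi_infinite_orbit)
  obtain N where N: "z 0 \<notin> Y closure_of {z i |i. i \<ge> N}"
    using nonrec by (auto simp: recurrent_point_def omega_limit_def orbit)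
  obtain M where M: "z 0 \<notin> Y closure_of {z i |i. i \<le> - M}"
    using nonrec by (auto simp: recurrent_point_def alpha_limit_def orbit)
  let ?A = "Y closure_of {z i |i. i \<ge> N}"
  let ?B = "Y closure_of {z i |i. i \<le> - M}"
  let ?F = "z ` {- M<..<N}"
  have finite_closed: "closedin Y K" if "finite K" "K \<subseteq> topspace Y" for K
    using t1 that by (simp add: t1_space_closedin_finite)
  have F_closed: "Y closure_of ?F = ?F"
    using finite_closed[of ?F] zY by (simp add: closure_of_closedin image_subset_iff)
  have "range z \<subseteq> {z i |i. i \<ge> N} \<union> {z i |i. i \<le> - M} \<union> ?F"
    by (force simp: not_le)
  then have "topspace Y \<subseteq> Y closure_of ({z i |i. i \<ge> N} \<union> {z i |i. i \<le> - M} \<union> ?F)"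
    unfolding dense[symmetric] by (rule closure_of_mono)
  also have "Y closure_of ({z i |i. i \<ge> N} \<union> {z i |i. i \<le> - M} \<union> ?F) = ?A \<union> ?B \<union> ?F"
    by (simp only: closure_of_Un F_closed)
  finally have cover: "topspace Y \<subseteq> ?A \<union> ?B \<union> ?F" .
  have "closedin Y (?A \<union> ?B \<union> (?F - {z 0}))"
    using zY by (intro closedin_Un closedin_closure_of finite_closed) auto
  then have "openin Y (topspace Y - (?A \<union> ?B \<union> (?F - {z 0})))"
    by blast
  moreover have "topspace Y - (?A \<union> ?B \<union> (?F - {z 0})) = {z 0}"
    using cover N M zY by blast
  ultimately show ?thesis
    by simp
qed

text \<open>The orbit of \<open>y = z 0\<close> is presented as a bi-infinite sequence \<open>z\<close> rather than through
  \<open>int_iterate\<close>: in the application it is the sequence of powers of \<open>T\<close>, and knowing it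
  in advance makes the iterates of \<open>S\<close> computable.\<close>

theorem dense_orbit_recurrent_of_weakly_mixing:
  fixes z :: "int \<Rightarrow> 'a"
  assumes t1: "t1_space Y"
    and inj: "inj_on S (topspace Y)"
    and zY: "\<And>i. z i \<in> topspace Y"
    and step: "\<And>i. S (z i) = z (i + 1)"
    and dense: "Y closure_of (range z) = topspace Y"
    and mixing: "weakly_mixing Y S"
  shows "recurrent_point Y S (z 0)"
proof (rule ccontr)
  assume nonrec: "\<not> recurrent_point Y S (z 0)"
  have isolated: "openin Y {z 0}"
    using assms(1-5) nonrec by (rule isolated_of_nonrecurrent_dense_orbit)
  have diagonal: "int_iterate (topspace Y \<times> topspace Y) (map_prod S S) i (z 0, z 0) = (z i, z i)" for i
    using int_iterate_bi_infinite_orbit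
      [of "map_prod S S" "topspace Y \<times> topspace Y" "\<lambda>i. (z i, z i)" i]
    by (simp add: map_prod_inj_on[OF inj inj] zY step)
  have singleton: "topspace Y = {z 0}"
  proof (rule ccontr)
    assume "topspace Y \<noteq> {z 0}"
    then have ne: "topspace Y - {z 0} \<noteq> {}"
      using zY by blast
    \<comment> \<open>The diagonal point \<open>(z 0, z 0)\<close> is to be moved into \<open>{z 0} \<times> (Y - {z 0})\<close>.\<close>
    have "openin Y (topspace Y - {z 0})"
      using t1 zY by (auto simp: t1_space_closedin_singleton)
    with isolated have "openin (prod_topology Y Y) ({z 0} \<times> {z 0})"
      and "openin (prod_topology Y Y) ({z 0} \<times> (topspace Y - {z 0}))"
      by (simp_all only: openin_prod_Times_iff simp_thms)
    moreover have "{z 0} \<times> {z 0} \<noteq> {}" and "{z 0} \<times> (topspace Y - {z 0}) \<noteq> {}"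
      using ne by auto
    ultimately have "\<exists>i. ({z 0} \<times> {z 0}) \<inter>
        int_iterate (topspace Y \<times> topspace Y) (map_prod S S) i -`
          ({z 0} \<times> (topspace Y - {z 0})) \<noteq> {}"
      using mixing[unfolded weakly_mixing_def transitive_cascade_def topspace_prod_topology,
          rule_format, of "{z 0} \<times> {z 0}" "{z 0} \<times> (topspace Y - {z 0})"]
      by (simp only: simp_thms)
    then show False
      by (auto simp: diagonal)
  qed
  have fixed: "int_iterate (topspace Y) S i (z 0) = z 0" for i
    using int_iterate_bi_infinite_orbit[of S "topspace Y" z i, OF inj zY step] zY[of i] singleton by simp
  have tail: "{int_iterate (topspace Y) S i (z 0) |i. i \<ge> N} = {z 0}" for N
    by (auto simp: fixed)
  have "z 0 \<in> omega_limit Y S (z 0)"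
    using closure_of_subset[of "{z 0}" Y] zY by (auto simp: omega_limit_def tail)
  with nonrec show False
    by (simp add: recurrent_point_def)
qed

lemma int_iterate_in_carrier:
  assumes "bij_betw T A A" and "x \<in> A"
  shows "int_iterate A T i x \<in> A"
proof -
  have "(T ^^ n) x \<in> A" for n
    using assms by (induction n) (auto dest: bij_betwE)
  moreover have "(inv_into A T ^^ n) x \<in> A" for n
    using assms by (induction n) (auto dest: bij_betwE[OF bij_betw_inv_into])
  ultimately show ?thesis
    by (simp add: int_iterate_def)
qed

lemma int_iterate_step:
  assumes "bij_betw T A A" and "x \<in> A"
  shows "T (int_iterate A T i x) = int_iterate A T (i + 1) x"
proof (cases "0 \<le> i")
  case True
  then show ?thesis
    by (simp add: int_iterate_def nat_add_distrib)
next
  case False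
  define n where "n = nat (- (i + 1))"
  have i: "i = - int (Suc n)"
    using False by (simp add: n_def)
  have next_i: "int_iterate A T (i + 1) x = (inv_into A T ^^ n) x"
    by (cases n) (simp_all add: i int_iterate_def nat_add_distrib del: funpow.simps)
  have "T (inv_into A T ((inv_into A T ^^ n) x)) = (inv_into A T ^^ n) x"
    using int_iterate_in_carrier[OF assms, of "i + 1"] unfolding next_i
    by (rule bij_betw_inv_into_right[OF assms(1)])
  moreover have "int_iterate A T i x = inv_into A T ((inv_into A T ^^ n) x)"
    by (simp add: i int_iterate_def nat_add_distrib)
  ultimately show ?thesis
    by (simp add: next_i)
qed

theorem corollary3p2:
  fixes X :: "'a topology" and T :: "'a \<Rightarrow> 'a"
  assumes "cascade X T"
    and "weakly_mixing (enveloping_semigroup X T) (enveloping_map X T)"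
  shows "weakly_rigid X T"
proof -
  define A where "A = topspace X"
  define P where "P = product_topology (\<lambda>_. X) A"
  define z where "z i = restrict (int_iterate A T i) A" for i
  define E where "E = enveloping_semigroup X T"
  have bij: "bij_betw T A A"
    using assms(1) homeomorphic_imp_injective_map homeomorphic_imp_surjective_map
    unfolding cascade_def A_def bij_betw_def by blast
  have E: "E = subtopology P (P closure_of range z)"
    by (simp add: E_def enveloping_semigroup_def Let_def P_def A_def z_def)
  have zP: "range z \<subseteq> topspace P"
    using int_iterate_in_carrier[OF bij] by (auto simp: P_def z_def A_def)
  have topE: "topspace E = P closure_of range z"
    by (simp add: E closure_of_subset_topspace inf_absorb2)
  have zE: "z i \<in> topspace E" for i
    using closure_of_subset[OF zP] by (auto simp: topE)
  have t1: "t1_space E"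
    using assms(1) unfolding E P_def cascade_def
    by (intro Hausdorff_imp_t1_space Hausdorff_space_subtopology)
      (simp add: Hausdorff_space_product_topology)
  have dense: "E closure_of range z = topspace E"
    using closure_of_subset[OF zP] closure_of_subset_topspace[of P "range z"]
    by (simp add: topE E closure_of_subtopology inf_absorb2)
  have inj: "inj_on (enveloping_map X T) (topspace E)"
  proof (rule inj_onI)
    fix p q
    assume pq: "p \<in> topspace E" "q \<in> topspace E" "enveloping_map X T p = enveloping_map X T q"
    then have carrier: "p \<in> A \<rightarrow>\<^sub>E A" "q \<in> A \<rightarrow>\<^sub>E A"
      by (auto simp: E P_def A_def)
    show "p = q"
    proof (rule PiE_ext[OF carrier])
      fix x assume "x \<in> A"
      then have "T (p x) = T (q x)"
        using fun_cong[OF pq(3), of x] by (simp add: enveloping_map_def A_def compose_def)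
      then show "p x = q x"
        using bij carrier \<open>x \<in> A\<close> by (auto simp: bij_betw_def dest: inj_onD)
    qed
  qed
  have step: "enveloping_map X T (z i) = z (i + 1)" for i
    using int_iterate_step[OF bij]
    by (auto simp: enveloping_map_def z_def A_def compose_def fun_eq_iff restrict_def)
  have "recurrent_point E (enveloping_map X T) (z 0)"
    using t1 inj zE step dense assms(2)[folded E_def]
    by (rule dense_orbit_recurrent_of_weakly_mixing)
  moreover have "z 0 = restrict id (topspace X)"
    by (auto simp: z_def A_def int_iterate_def)
  ultimately show ?thesis
    by (simp add: weakly_rigid_def E_def)
qed

end
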